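(* Let $n\ge1$ and $m\ge2$ be two integers and $d=\gcd(m,n)$. Then $$[\mathbb{Z}_{2n}^-]\circledcirc[\mathbb{D}_m\oplus\mathbb{Z}_2^c]=\begin{cases}\{[\mathbb{1}],[\mathbb{Z}_{2d}^-],\mathcal{Z}(n)\}&\text{if } m/d\text{ is even},\\ \{[\mathbb{1}],[\mathbb{Z}_d],\mathcal{Z}(n)\}&\text{otherwise},\end{cases}$$ where $\mathcal{Z}(n)=[\mathbb{Z}_2]$ if $n$ is even and $\mathcal{Z}(n)=[\mathbb{Z}_2^-]$ if $n$ is odd.
   Context: $[K]$ is the conjugacy class of a subgroup $K$ in $\mathrm{O}(3)$, and the clips operation is $[H_1]\circledcirc[H_2]=\{[H_1\cap gH_2g^{-1}]:g\in\mathrm{O}(3)\}$. $(e_1,e_2,e_3)$ is the canonical basis of $\mathbb{R}^3$, $\mathbf{r}(n,\theta)$ is the rotation by angle $\theta$ about the axis directed by $n\neq0$. $\mathbb{1}=\{\mathrm{Id}\}$; $\mathbb{Z}_2^c=\{\pm\mathrm{Id}\}$; $H\oplus\mathbb{Z}_2^c=H\cup(-H)$ for $H\subset\mathrm{SO}(3)$; $\mathbb{Z}_k=\{\mathbf{r}(e_3,2j\pi/k):0\le j\le k-1\}$, with $\mathbb{Z}_1=\mathbb{1}$; $\mathbb{D}_k=\langle\mathbf{r}(e_3,2\pi/k),\mathbf{r}(e_1,\pi)\rangle$ for $k\ge2$; $\mathbb{Z}_{2k}^-=\mathbb{Z}_k\cup(-\mathbf{r}(e_3,\pi/k))\mathbb{Z}_k$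 for $k\ge1$. *)

theory Defs
  imports "HOL-Analysis.Analysis" "HOL-Algebra.Generated_Groups"
begin

unbundle cross3_syntax

definition O3 :: "(real^3^3) monoid" where
  "O3 = \<lparr>carrier = {A. orthogonal_matrix A}, mult = (**), one = mat 1\<rparr>"

definition conj_by :: "real^3^3 \<Rightarrow> (real^3^3) set \<Rightarrow> (real^3^3) set" where
  "conj_by g H = (\<lambda>h. g \<otimes>\<^bsub>O3\<^esub> h \<otimes>\<^bsub>O3\<^esub> inv\<^bsub>O3\<^esub> g) ` H"

definition conj_class :: "(real^3^3) set \<Rightarrow> (real^3^3) set set" where
  "conj_class K = {conj_by g K | g. g \<in> carrier O3}"

text \<open>The clips operation acts on conjugacy classes, so it ranges over all representatives;
  lemma \<open>clips_conj_class\<close> below shows that fixed representatives suffice.\<close>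

definition clips :: "(real^3^3) set set \<Rightarrow> (real^3^3) set set \<Rightarrow> (real^3^3) set set set"
    (infixl "\<circledcirc>" 70) where
  "C1 \<circledcirc> C2 =
     {conj_class (H1 \<inter> conj_by g H2) | H1 H2 g. H1 \<in> C1 \<and> H2 \<in> C2 \<and> g \<in> carrier O3}"

text \<open>Rotation by the angle \<open>\<theta>\<close>, counterclockwise (right-hand rule) about the axis
  directed by \<open>n\<close>, given by Rodrigues' formula. Meaningful only for \<open>n \<noteq> 0\<close>.\<close>

definition rot :: "real^3 \<Rightarrow> real \<Rightarrow> real^3^3" where
  "rot n \<theta> = matrix (\<lambda>v. let u = n /\<^sub>R norm n in
     cos \<theta> *\<^sub>R v + sin \<theta> *\<^sub>R (u \<times> v) + ((1 - cos \<theta>) * (u \<bullet> v)) *\<^sub>R u)"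

abbreviation e1 :: "real^3" where "e1 \<equiv> axis 1 1"
abbreviation e3 :: "real^3" where "e3 \<equiv> axis 3 1"

definition trivial_subgroup :: "(real^3^3) set" where
  "trivial_subgroup = {mat 1}"

definition Zrot :: "nat \<Rightarrow> (real^3^3) set" where
  "Zrot k = {rot e3 (2 * real j * pi / real k) | j. j < k}"

definition Dih :: "nat \<Rightarrow> (real^3^3) set" where
  "Dih k = generate O3 {rot e3 (2 * pi / real k), rot e1 pi}"

text \<open>\<open>Zminus k\<close> is \<open>\<int>\<close>\<open>\<^sub>2\<^sub>k\<^sup>-\<close>, of order \<open>2 * k\<close>: the argument is \<open>k\<close>, not the subscript \<open>2 * k\<close>.\<close>

definition Zminus :: "nat \<Rightarrow> (real^3^3) set" where
  "Zminus k = Zrot k \<union> (\<lambda>h. (- rot e3 (pi / real k)) ** h) ` Zrot k"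

text \<open>\<open>H \<oplus> \<int>\<^sub>2\<^sup>c = H \<union> (- H)\<close>, for \<open>H\<close> a set of rotations.\<close>

definition plus_Z2c :: "(real^3^3) set \<Rightarrow> (real^3^3) set" where
  "plus_Z2c H = H \<union> uminus ` H"

definition Zcal :: "nat \<Rightarrow> (real^3^3) set set" where
  "Zcal n = (if even n then conj_class (Zrot 2) else conj_class (Zminus 1))"

lemma group_O3: "group O3"
proof (rule groupI)
  fix A assume "A \<in> carrier O3"
  then show "\<exists>B\<in>carrier O3. B \<otimes>\<^bsub>O3\<^esub> A = \<one>\<^bsub>O3\<^esub>"
    by (intro bexI[of _ "transpose A"])
       (auto simp: O3_def orthogonal_matrix_def)
qed (auto simp: O3_def orthogonal_matrix_mul orthogonal_matrix_id matrix_mul_assoc)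

lemma conj_by_mult:
  assumes "g \<in> carrier O3" "h \<in> carrier O3" "H \<subseteq> carrier O3"
  shows "conj_by g (conj_by h H) = conj_by (g \<otimes>\<^bsub>O3\<^esub> h) H"
proof -
  interpret group O3 by (rule group_O3)
  show ?thesis
    unfolding conj_by_def image_image
    by (rule image_cong) (use assms in \<open>auto simp: inv_mult_group m_assoc\<close>)
qed

lemma conj_by_closed:
  assumes "g \<in> carrier O3" "H \<subseteq> carrier O3"
  shows "conj_by g H \<subseteq> carrier O3"
proof -
  interpret group O3 by (rule group_O3)
  show ?thesis using assms unfolding conj_by_def by auto
qed

lemma conj_by_one:
  assumes "H \<subseteq> carrier O3"
  shows "conj_by \<one>\<^bsub>O3\<^esub> H = H"
proof -
  interpret group O3 by (rule group_O3)
  have "conj_by \<one>\<^bsub>O3\<^esub> H = (\<lambda>h. h) ` H"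
    unfolding conj_by_def by (rule image_cong) (use assms in auto)
  then show ?thesis by simp
qed

lemma conj_by_Int:
  assumes "g \<in> carrier O3" "H \<subseteq> carrier O3" "K \<subseteq> carrier O3"
  shows "conj_by g (H \<inter> K) = conj_by g H \<inter> conj_by g K"
proof -
  interpret group O3 by (rule group_O3)
  have "inj_on (\<lambda>h. g \<otimes>\<^bsub>O3\<^esub> h \<otimes>\<^bsub>O3\<^esub> inv\<^bsub>O3\<^esub> g) (carrier O3)"
    using assms(1) by (auto simp: inj_on_def)
  then show ?thesis
    unfolding conj_by_def using assms(2,3) by (rule inj_on_image_Int)
qed

lemma conj_class_conj_by:
  assumes "g \<in> carrier O3" "H \<subseteq> carrier O3"
  shows "conj_class (conj_by g H) = conj_class H"
proof -
  interpret group O3 by (rule group_O3)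
  have "conj_by k H \<in> conj_class (conj_by g H)" if "k \<in> carrier O3" for k
  proof -
    have "conj_by k H = conj_by (k \<otimes>\<^bsub>O3\<^esub> inv\<^bsub>O3\<^esub> g) (conj_by g H)"
      using assms that by (simp add: conj_by_mult m_assoc)
    moreover have "k \<otimes>\<^bsub>O3\<^esub> inv\<^bsub>O3\<^esub> g \<in> carrier O3"
      using assms that by simp
    ultimately show ?thesis unfolding conj_class_def by blast
  qed
  moreover have "conj_by k (conj_by g H) \<in> conj_class H" if "k \<in> carrier O3" for k
    using assms that by (auto simp: conj_by_mult conj_class_def)
  ultimately show ?thesis by (fastforce simp: conj_class_def)
qed

lemma clips_conj_class:
  assumes "H1 \<subseteq> carrier O3" "H2 \<subseteq> carrier O3"
  shows "conj_class H1 \<circledcirc> conj_class H2 =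
    {conj_class (H1 \<inter> conj_by g H2) | g. g \<in> carrier O3}"  (is "?L = ?R")
proof
  interpret group O3 by (rule group_O3)
  show "?L \<subseteq> ?R"
  proof
    fix X assume "X \<in> ?L"
    then obtain a b g where abg: "a \<in> carrier O3" "b \<in> carrier O3" "g \<in> carrier O3"
      and X: "X = conj_class (conj_by a H1 \<inter> conj_by g (conj_by b H2))"
      by (auto simp: clips_def conj_class_def)
    define k where "k = inv\<^bsub>O3\<^esub> a \<otimes>\<^bsub>O3\<^esub> (g \<otimes>\<^bsub>O3\<^esub> b)"
    have k: "k \<in> carrier O3" using abg by (simp add: k_def)
    have ak: "a \<otimes>\<^bsub>O3\<^esub> k = g \<otimes>\<^bsub>O3\<^esub> b"
      using abg by (simp add: k_def m_assoc[symmetric])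
    have "conj_by a H1 \<inter> conj_by g (conj_by b H2) = conj_by a (H1 \<inter> conj_by k H2)"
      using abg k ak assms by (simp add: conj_by_Int conj_by_mult conj_by_closed)
    then have "X = conj_class (H1 \<inter> conj_by k H2)"
      using X abg(1) assms by (simp add: conj_class_conj_by le_infI1)
    then show "X \<in> ?R" using k by blast
  qed
  have self: "H \<in> conj_class H" if "H \<subseteq> carrier O3" for H
    using conj_by_one[OF that] one_closed unfolding conj_class_def by blast
  show "?R \<subseteq> ?L"
    using self[OF assms(1)] self[OF assms(2)] unfolding clips_def by blast
qed

lemma rot_e3:
  "rot e3 \<theta> = vector [vector [cos \<theta>, - sin \<theta>, 0], vector [sin \<theta>, cos \<theta>, 0], vector [0, 0, 1]]"
  by (simp add: rot_def matrix_def vec_eq_iff forall_3 cross3_def axis_def inner_vec_def sum_3 norm_vec_def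
      L2_set_def)

lemma rot_e1:
  "rot e1 \<theta> = vector [vector [1, 0, 0], vector [0, cos \<theta>, - sin \<theta>], vector [0, sin \<theta>, cos \<theta>]]"
  by (simp add: rot_def matrix_def vec_eq_iff forall_3 cross3_def axis_def inner_vec_def sum_3 norm_vec_def
      L2_set_def)

end

theory Submission
  imports Defs
begin

text \<open>
  Why the result holds. All elements of \<open>Zminus n\<close> are, up to sign, rotations about \<open>e3\<close>; more
  precisely the group is cyclic, consisting of the matrices \<open>(-1)\<^sup>a rot e3 (a \<pi> / n)\<close>
  (\<open>Zminus_signed\<close>). The group \<open>plus_Z2c (Dih m)\<close> and its conjugates contain both signs of every
  element, and comparing determinants shows that such an element lies in the conjugate by \<open>g\<close> if and
  only if its rotation part lies in the conjugate of \<open>Dih m\<close> (\<open>Zminus_Int_conj_plus_Z2c\<close>). So the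
  only question is which rotations about \<open>e3\<close> are conjugate by \<open>g\<close> to elements of \<open>Dih m\<close>, with
  the sign carried along as a passive label.

  The answer depends only on the unit vector \<open>v = transpose g *v e3\<close>, the third row of \<open>g\<close>, since
  any element of \<open>Dih m\<close> that becomes a rotation about \<open>e3\<close> must fix \<open>v\<close>
  (\<open>rot_e3_conj_Dih_cases\<close>).
  If \<open>v\<close> is \<open>e3\<close> or \<open>- e3\<close>, the two principal axes agree and what remains is
  \<open>(-1)\<^sup>a rot e3 (a \<pi> / n)\<close> with \<open>2 n\<close> dividing \<open>m a\<close>. Writing \<open>m = d m'\<close>, \<open>n = d n'\<close> with
  \<open>m'\<close>, \<open>n'\<close> coprime, this says \<open>a = n' c\<close> with \<open>m' c\<close> even. For even \<open>m'\<close> every \<open>c\<close>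
  is admitted and \<open>n'\<close> is odd, so that the sign is \<open>(-1)\<^sup>c\<close> and the group is \<open>Zminus d\<close>; for odd
  \<open>m'\<close> only even \<open>c\<close> occur, the sign is positive, and the group is \<open>Zrot d\<close>
  (\<open>signed_rotations_in_Zrot\<close>).
  Otherwise the only element of \<open>Dih m\<close> besides the identity that can fix \<open>v\<close> is a half-turn,
  so the intersection is trivial or has one further element, the one with \<open>a = n\<close>. That element is
  \<open>(-1)\<^sup>n rot e3 \<pi>\<close>, whence the dependence of \<open>Zcal n\<close> on the parity of \<open>n\<close>
  (\<open>signed_rotations_half_turn\<close>).

  All three cases occur: for \<open>g\<close> the identity, for \<open>g\<close> a permutation of the axes taking the flip
  axis \<open>e1\<close> to \<open>e3\<close>, and for a tilt by \<open>\<pi> / 4\<close>, where \<open>v\<close> is neither vertical nor horizontal.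
\<close>

section \<open>Conjugation and rotations about the third axis\<close>

lemmas mat3_simps = vec_eq_iff forall_3 matrix_matrix_mult_def sum_3 vector_3 mat_def transpose_def

lemma carrier_O3_iff: "A \<in> carrier O3 \<longleftrightarrow> orthogonal_matrix A"
  by (simp add: O3_def)

lemma inv_O3: "orthogonal_matrix g \<Longrightarrow> inv\<^bsub>O3\<^esub> g = transpose g"
proof -
  assume g: "orthogonal_matrix g"
  interpret group O3 by (rule group_O3)
  show ?thesis
    by (rule inv_equality) (use g in \<open>auto simp: O3_def orthogonal_matrix_def\<close>)
qed

lemma conj_by_transpose:
  "orthogonal_matrix g \<Longrightarrow> conj_by g H = (\<lambda>h. g ** h ** transpose g) ` H"
  by (simp add: conj_by_def inv_O3) (simp add: O3_def)

lemma rot_e3_0: "rot e3 0 = mat 1"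
  by (simp add: rot_e3 mat3_simps)

lemma rot_e3_mult: "rot e3 \<alpha> ** rot e3 \<beta> = rot e3 (\<alpha> + \<beta>)"
  by (simp add: rot_e3 mat3_simps cos_add sin_add)

lemma transpose_rot_e3: "transpose (rot e3 \<theta>) = rot e3 (- \<theta>)"
  by (simp add: rot_e3 mat3_simps)

lemma det_rot_e3: "det (rot e3 \<theta>) = 1"
  using sin_cos_squared_add[of \<theta>] by (simp add: rot_e3 det_3 power2_eq_square algebra_simps)

lemma trace_rot_e3: "trace (rot e3 \<theta>) = 1 + 2 * cos \<theta>"
  by (simp add: rot_e3 trace_def sum_3)

lemma orthogonal_rot_e3: "orthogonal_matrix (rot e3 \<theta>)"
  by (simp add: orthogonal_matrix transpose_rot_e3 rot_e3_mult rot_e3_0)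

lemma orthogonal_rot_e1: "orthogonal_matrix (rot e1 \<theta>)"
  using sin_cos_squared_add[of \<theta>]
  by (simp add: orthogonal_matrix rot_e1 mat3_simps power2_eq_square algebra_simps)

lemma rot_e3_eq_iff: "rot e3 \<alpha> = rot e3 \<beta> \<longleftrightarrow> (\<exists>k::int. \<alpha> = \<beta> + 2 * pi * k)"
proof -
  have "rot e3 \<alpha> = rot e3 \<beta> \<longleftrightarrow> sin \<alpha> = sin \<beta> \<and> cos \<alpha> = cos \<beta>"
    by (auto simp: rot_e3 mat3_simps)
  then show ?thesis by (simp add: sin_cos_eq_iff)
qed

lemma flip_rot_e3: "rot e1 pi ** rot e3 \<theta> = rot e3 (- \<theta>) ** rot e1 pi"
  by (simp add: rot_e3 rot_e1 mat3_simps)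

lemma flip_flip: "rot e1 pi ** rot e1 pi = mat 1"
  by (simp add: rot_e1 mat3_simps)

text \<open>Letting the index range over all integers makes closure under products and inverses
  immediate, where the index range of the definition would need reductions modulo \<open>k\<close>.\<close>

lemma Zrot_int:
  assumes "k \<ge> 1"
  shows "Zrot k = range (\<lambda>a. rot e3 (2 * pi * real_of_int a / real k))"
proof (intro Set.set_eqI iffI)
  fix x assume "x \<in> Zrot k"
  then obtain j where "x = rot e3 (2 * pi * real_of_int (int j) / real k)"
    by (auto simp: Zrot_def mult_ac)
  then show "x \<in> range (\<lambda>a. rot e3 (2 * pi * real_of_int a / real k))" by blast
next
  fix x assume "x \<in> range (\<lambda>a. rot e3 (2 * pi * real_of_int a / real k))"
  then obtain a where x: "x = rot e3 (2 * pi * real_of_int a / real k)" by blast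
  define j where "j = nat (a mod int k)"
  have j: "int j = a mod int k" using assms by (simp add: j_def)
  have "real_of_int a = real j + real k * real_of_int (a div int k)"
    using j by (metis mod_mult_div_eq of_int_add of_int_mult of_int_of_nat_eq)
  then have "2 * pi * real_of_int a / real k
    = 2 * real j * pi / real k + 2 * pi * real_of_int (a div int k)"
    using assms by (simp add: field_simps)
  then have "x = rot e3 (2 * real j * pi / real k)"
    unfolding x rot_e3_eq_iff by blast
  moreover have "j < k" using assms j by (metis less_eq_Suc_le One_nat_def of_nat_0_less_iff of_nat_less_iff pos_mod_bound)
  ultimately show "x \<in> Zrot k" by (auto simp: Zrot_def)
qed

lemma one_mem_Zrot:
  assumes "k \<ge> 1"
  shows "mat 1 \<in> Zrot k"
proof -
  have "mat 1 = rot e3 (2 * pi * real_of_int 0 / real k)" by (simp add: rot_e3_0)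
  then show ?thesis unfolding Zrot_int[OF assms] by blast
qed

section \<open>The cyclic group of rotation-reflections\<close>

text \<open>With \<open>M\<close> a matrix of determinant one, this is \<open>(-1)\<^sup>a M\<close>: the integer \<open>a\<close> records
  whether the element lies in the proper or the improper half of a group.\<close>

definition signed :: "int \<Rightarrow> real^3^3 \<Rightarrow> real^3^3" where
  "signed a M = (if even a then M else - M)"

text \<open>Even indices give \<open>Zrot k\<close> and odd ones the coset of \<open>- rot e3 (\<pi> / k)\<close>: the group is
  generated by this single element.\<close>

lemma Zminus_signed:
  assumes "k \<ge> 1"
  shows "Zminus k = range (\<lambda>a. signed a (rot e3 (pi * real_of_int a / real k)))"
proof -
  have odd_part: "(- rot e3 (pi / real k)) ** rot e3 (2 * pi * real_of_int a / real k)
      = - rot e3 (pi * real_of_int (2 * a + 1) / real k)" for a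
  proof -
    have "(- rot e3 (pi / real k)) ** rot e3 (2 * pi * real_of_int a / real k)
      = - (rot e3 (pi / real k) ** rot e3 (2 * pi * real_of_int a / real k))"
      by (simp add: mat3_simps)
    then show ?thesis using assms by (simp add: rot_e3_mult field_simps)
  qed
  show ?thesis
  proof (intro Set.set_eqI iffI)
    fix x assume "x \<in> Zminus k"
    then consider a where "x = rot e3 (2 * pi * real_of_int a / real k)"
      | a where "x = - rot e3 (pi * real_of_int (2 * a + 1) / real k)"
      unfolding Zminus_def Zrot_int[OF assms] using odd_part by auto
    then show "x \<in> range (\<lambda>a. signed a (rot e3 (pi * real_of_int a / real k)))"
    proof cases
      case 1
      then have "x = signed (2 * a) (rot e3 (pi * real_of_int (2 * a) / real k))"
        by (simp add: signed_def mult_ac)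
      then show ?thesis by blast
    next
      case 2
      then have "x = signed (2 * a + 1) (rot e3 (pi * real_of_int (2 * a + 1) / real k))"
        by (simp add: signed_def)
      then show ?thesis by blast
    qed
  next
    fix x assume "x \<in> range (\<lambda>a. signed a (rot e3 (pi * real_of_int a / real k)))"
    then obtain a where x: "x = signed a (rot e3 (pi * real_of_int a / real k))" by blast
    show "x \<in> Zminus k"
    proof (cases "even a")
      case True
      then obtain b where "a = 2 * b" by blast
      then have "x = rot e3 (2 * pi * real_of_int b / real k)"
        using x by (simp add: signed_def mult_ac)
      then show ?thesis unfolding Zminus_def Zrot_int[OF assms] by blast
    next
      case False
      then obtain b where "a = 2 * b + 1" by (elim oddE)
      then have "x = (- rot e3 (pi / real k)) ** rot e3 (2 * pi * real_of_int b / real k)"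
        using x by (simp add: signed_def odd_part)
      then show ?thesis unfolding Zminus_def Zrot_int[OF assms] by blast
    qed
  qed
qed

lemma Zminus_carrier:
  assumes "k \<ge> 1"
  shows "Zminus k \<subseteq> carrier O3"
proof -
  have "orthogonal_matrix (- rot e3 \<theta>)" for \<theta>
    using orthogonal_rot_e3[of \<theta>] by (simp add: orthogonal_matrix_def mat3_simps)
  then show ?thesis
    unfolding Zminus_signed[OF assms] by (auto simp: carrier_O3_iff signed_def orthogonal_rot_e3)
qed

section \<open>The dihedral group and the passage to rotations\<close>

text \<open>The right-hand side is a subgroup because the flip about \<open>e1\<close> inverts rotations about \<open>e3\<close>
  when moved past them; for a rotation matrix inversion is transposition.\<close>

lemma Dih_eq:
  assumes "m \<ge> 1"
  shows "Dih m = Zrot m \<union> (\<lambda>r. r ** rot e1 pi) ` Zrot m" (is "_ = ?D")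
proof
  interpret group O3 by (rule group_O3)
  have mult: "x \<otimes>\<^bsub>O3\<^esub> y = x ** y" for x y by (simp add: O3_def)
  have one: "\<one>\<^bsub>O3\<^esub> = mat 1" by (simp add: O3_def)
  note Z = Zrot_int[OF assms]
  have Zmult: "x ** y \<in> Zrot m" if xy: "x \<in> Zrot m" "y \<in> Zrot m" for x y
  proof -
    obtain a b where "x = rot e3 (2 * pi * real_of_int a / real m)"
      "y = rot e3 (2 * pi * real_of_int b / real m)" using xy unfolding Z by blast
    then have "x ** y = rot e3 (2 * pi * real_of_int (a + b) / real m)"
      by (simp add: rot_e3_mult add_divide_distrib ring_distribs)
    then show ?thesis unfolding Z by blast
  qed
  have Ztr: "transpose x \<in> Zrot m" if x: "x \<in> Zrot m" for x
  proof -
    obtain a where "x = rot e3 (2 * pi * real_of_int a / real m)" using x unfolding Z by blast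
    then have "transpose x = rot e3 (2 * pi * real_of_int (- a) / real m)"
      by (simp add: transpose_rot_e3)
    then show ?thesis unfolding Z by blast
  qed
  have Zflip: "rot e1 pi ** x = transpose x ** rot e1 pi" if "x \<in> Zrot m" for x
    using that unfolding Z by (auto simp: flip_rot_e3 transpose_rot_e3)
  have flip_T: "transpose (rot e1 pi) = rot e1 pi" by (simp add: rot_e1 mat3_simps)
  note Zone = one_mem_Zrot[OF assms]
  have car: "?D \<subseteq> carrier O3"
    unfolding Z by (auto simp: carrier_O3_iff orthogonal_rot_e3 orthogonal_rot_e1 orthogonal_matrix_mul)
  have sub: "subgroup ?D O3"
  proof (rule subgroupI)
    show "?D \<subseteq> carrier O3" by (rule car)
    show "?D \<noteq> {}" using Zone by blast
  next
    fix x assume x: "x \<in> ?D"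
    then have inv: "inv\<^bsub>O3\<^esub> x = transpose x"
      using car by (auto simp: carrier_O3_iff inv_O3)
    from x consider "x \<in> Zrot m" | r where "r \<in> Zrot m" "x = r ** rot e1 pi" by blast
    then show "inv\<^bsub>O3\<^esub> x \<in> ?D"
    proof cases
      case 1 then show ?thesis using Ztr inv by simp
    next
      case 2
      then have "transpose x = r ** rot e1 pi"
        using Zflip[OF Ztr[OF 2(1)]] by (simp add: matrix_transpose_mul flip_T)
      then show ?thesis using 2(1) unfolding inv by blast
    qed
  next
    fix x y assume "x \<in> ?D" "y \<in> ?D"
    then consider "x \<in> Zrot m" "y \<in> Zrot m"
      | r where "x \<in> Zrot m" "r \<in> Zrot m" "y = r ** rot e1 pi"
      | r where "r \<in> Zrot m" "y \<in> Zrot m" "x = r ** rot e1 pi"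
      | r s where "r \<in> Zrot m" "s \<in> Zrot m" "x = r ** rot e1 pi" "y = s ** rot e1 pi"
      by blast
    then show "x \<otimes>\<^bsub>O3\<^esub> y \<in> ?D"
    proof cases
      case 1 then show ?thesis by (simp add: mult Zmult)
    next
      case 2
      then have "x ** y = (x ** r) ** rot e1 pi" by (simp add: matrix_mul_assoc)
      then show ?thesis using Zmult[OF 2(1,2)] unfolding mult by blast
    next
      case 3
      have "x ** y = r ** (rot e1 pi ** y)" unfolding 3(3) by (rule matrix_mul_assoc[symmetric])
      also have "\<dots> = (r ** transpose y) ** rot e1 pi"
        unfolding Zflip[OF 3(2)] by (rule matrix_mul_assoc)
      finally show ?thesis using Zmult[OF 3(1) Ztr[OF 3(2)]] unfolding mult by blast
    next
      case 4
      then have "x ** y = r ** ((rot e1 pi ** s) ** rot e1 pi)"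
        by (simp add: matrix_mul_assoc)
      also have "\<dots> = r ** transpose s"
        unfolding Zflip[OF 4(2)] by (simp add: matrix_mul_assoc[symmetric] flip_flip)
      finally show ?thesis using Zmult[OF 4(1) Ztr[OF 4(2)]] unfolding mult by simp
    qed
  qed
  have flipD: "rot e1 pi \<in> ?D" using Zone by (metis UnI2 imageI matrix_mul_lid)
  have "rot e3 (2 * pi / real m) = rot e3 (2 * pi * real_of_int 1 / real m)" by simp
  then have "rot e3 (2 * pi / real m) \<in> Zrot m" unfolding Z by blast
  then show "Dih m \<subseteq> ?D"
    unfolding Dih_def using flipD sub by (intro generate_subgroup_incl) auto
  let ?gen = "{rot e3 (2 * pi / real m), rot e1 pi}"
  have powers: "rot e3 (2 * real j * pi / real m) \<in> generate O3 ?gen" for j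
  proof (induction j)
    case 0
    then show ?case using generate.one[of O3 ?gen] by (simp add: rot_e3_0 one)
  next
    case (Suc j)
    have "rot e3 (2 * real (Suc j) * pi / real m)
      = rot e3 (2 * real j * pi / real m) \<otimes>\<^bsub>O3\<^esub> rot e3 (2 * pi / real m)"
      by (simp add: mult rot_e3_mult add_divide_distrib ring_distribs add_ac)
    then show ?case using generate.eng[OF Suc generate.incl[of "rot e3 (2 * pi / real m)"]] by simp
  qed
  have flip: "rot e1 pi \<in> generate O3 ?gen" by (rule generate.incl) simp
  have "r \<in> Dih m \<and> r ** rot e1 pi \<in> Dih m" if "r \<in> Zrot m" for r
    using that powers generate.eng[OF powers flip] by (auto simp: Zrot_def Dih_def mult)
  then show "?D \<subseteq> Dih m" by blast
qed

lemma Dih_carrier: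
  assumes "m \<ge> 1" shows "Dih m \<subseteq> carrier O3"
  using assms unfolding Dih_eq[OF assms] Zrot_def
  by (auto simp: carrier_O3_iff orthogonal_rot_e3 orthogonal_rot_e1 orthogonal_matrix_mul)

lemma det_Dih:
  assumes "m \<ge> 1" "s \<in> Dih m" shows "det s = 1"
proof -
  have "det (rot e1 pi) = 1" by (simp add: rot_e1 det_3)
  then show ?thesis
    using assms(2) unfolding Dih_eq[OF assms(1)] Zrot_def by (auto simp: det_rot_e3 det_mul)
qed

lemma uminus_carrier_O3: "A \<in> carrier O3 \<Longrightarrow> - A \<in> carrier O3"
proof -
  have "transpose (- A) ** (- A) = transpose A ** A" for A :: "real^3^3"
    by (simp add: vec_eq_iff matrix_matrix_mult_def transpose_def)
  then show "A \<in> carrier O3 \<Longrightarrow> - A \<in> carrier O3"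
    by (simp add: carrier_O3_iff orthogonal_matrix)
qed

lemma conj_by_plus_Z2c:
  assumes "orthogonal_matrix g"
  shows "conj_by g (plus_Z2c H) = plus_Z2c (conj_by g H)"
proof -
  have "g ** (- h) ** transpose g = - (g ** h ** transpose g)" for h :: "real^3^3"
    by (simp add: vec_eq_iff matrix_matrix_mult_def sum_negf)
  then have "conj_by g (uminus ` H) = uminus ` conj_by g H"
    unfolding conj_by_transpose[OF assms] image_image by (simp only:)
  then show ?thesis
    unfolding plus_Z2c_def conj_by_def image_Un by (simp only:)
qed

text \<open>In odd dimension negation changes the sign of the determinant, so a matrix of determinant one
  can only come from the unsigned copy of \<open>K\<close>.\<close>

lemma signed_mem_plus_Z2c:
  assumes "\<And>k. k \<in> K \<Longrightarrow> det k = 1" "det R = 1"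
  shows "signed a R \<in> plus_Z2c K \<longleftrightarrow> R \<in> K"
proof -
  have neg: "det (- A) = - det A" for A :: "real^3^3" by (simp add: det_3)
  have "R \<noteq> - k" if "k \<in> K" for k
  proof
    assume "R = - k"
    then have "det R = - det k" by (simp only: neg)
    then show False using assms that by simp
  qed
  moreover have "- R \<notin> K"
  proof
    assume "- R \<in> K"
    from assms(1)[OF this] have "- det R = 1" by (simp only: neg)
    then show False using assms(2) by simp
  qed
  ultimately have "R \<notin> uminus ` K" "- R \<notin> K" by blast+
  moreover have "- R \<in> uminus ` K \<longleftrightarrow> R \<in> K" by (rule inj_image_mem_iff) simp
  ultimately show ?thesis by (simp add: plus_Z2c_def signed_def)
qed

lemma Zminus_Int_conj_plus_Z2c:
  assumes n: "n \<ge> 1" and g: "orthogonal_matrix g" and H: "\<And>h. h \<in> H \<Longrightarrow> det h = 1"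
  shows "Zminus n \<inter> conj_by g (plus_Z2c H) =
    {signed a (rot e3 (pi * real_of_int a / real n)) | a.
       rot e3 (pi * real_of_int a / real n) \<in> conj_by g H}"
proof -
  have "det g * det g = 1" using g by (metis det_I det_mul det_transpose orthogonal_matrix)
  then have "det k = 1" if "k \<in> conj_by g H" for k
    using that H by (auto simp: conj_by_transpose[OF g] det_mul det_transpose mult_ac)
  then show ?thesis
    unfolding Zminus_signed[OF n] conj_by_plus_Z2c[OF g]
    using signed_mem_plus_Z2c[where K = "conj_by g H"] det_rot_e3 by blast
qed

section \<open>Which conjugates of dihedral elements are rotations about the third axis\<close>

text \<open>Here \<open>g\<close> preserves the third axis, so it acts on the horizontal plane by an orthogonal
  \<open>2 \<times> 2\<close> block; \<open>s\<close> is the determinant of that block, which tells whether \<open>g\<close> keeps or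
  reverses the sense of horizontal rotations.\<close>

lemma conj_rot_e3_vertical:
  assumes g: "orthogonal_matrix g" and v: "g $ 3 $ 1 = 0" "g $ 3 $ 2 = 0"
  obtains s where "s = 1 \<or> s = -1"
    "\<And>\<theta>. g ** rot e3 \<theta> ** transpose g = rot e3 (s * \<theta>)"
proof -
  define a b c d where "a = g $ 1 $ 1" and "b = g $ 1 $ 2" and "c = g $ 2 $ 1" and "d = g $ 2 $ 2"
  note abcd = a_def[symmetric] b_def[symmetric] c_def[symmetric] d_def[symmetric]
  have "g ** transpose g = mat 1" using g by (simp add: orthogonal_matrix_def)
  then have entry: "(\<Sum>k\<in>UNIV. g$i$k * g$j$k) = (if i = j then 1 else 0)" for i j
    by (simp add: vec_eq_iff matrix_matrix_mult_def transpose_def mat_def)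
  have g33: "g$3$3 * g$3$3 = 1" using entry[of 3 3] v by (simp add: sum_3)
  have g13: "g$1$3 = 0" using entry[of 1 3] v g33 by (auto simp: sum_3)
  have g23: "g$2$3 = 0" using entry[of 2 3] v g33 by (auto simp: sum_3)
  have e: "a * a + b * b = 1" "c * c + d * d = 1" "a * c + b * d = 0"
    using entry[of 1 1] entry[of 2 2] entry[of 1 2] g13 g23 by (simp_all add: sum_3 abcd)
  define s where "s = a * d - b * c"
  \<comment> \<open>Lagrange's identity in the plane.\<close>
  have "s * s = (a * a + b * b) * (c * c + d * d) - (a * c + b * d) * (a * c + b * d)"
    by (simp add: s_def algebra_simps)
  then have "s * s = 1" using e by simp
  then have s: "s = 1 \<or> s = -1" by (simp add: square_eq_1_iff)
  have "g ** rot e3 \<theta> ** transpose g = rot e3 (s * \<theta>)" for \<theta>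
  proof -
    have trig: "cos (s * \<theta>) = cos \<theta>" "sin (s * \<theta>) = (a * d - b * c) * sin \<theta>"
      using s by (auto simp flip: s_def)
    have scale: "x * x' * cos \<theta> + y * y' * cos \<theta> = (x * x' + y * y') * cos \<theta>" for x x' y y'
      by (simp add: algebra_simps)
    have e': "a * (a * cos \<theta>) + b * (b * cos \<theta>) = cos \<theta>"
      "c * (c * cos \<theta>) + d * (d * cos \<theta>) = cos \<theta>"
      "a * (c * cos \<theta>) + b * (d * cos \<theta>) = 0"
      using scale[of a a b b] scale[of c c d d] scale[of a c b d] e by (simp_all add: mult.assoc)
    have g: "g = vector [vector [a, b, 0], vector [c, d, 0], vector [0, 0, g$3$3]]"
      using v g13 g23 by (simp add: vec_eq_iff forall_3 vector_3 abcd)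
    define h where "h = g$3$3"
    have hh: "h * h = 1" using g33 by (simp add: h_def)
    have "vector [vector [a, b, 0], vector [c, d, 0], vector [0, 0, h]] ** rot e3 \<theta> **
        transpose (vector [vector [a, b, 0], vector [c, d, 0], vector [0, 0, h]]) = rot e3 (s * \<theta>)"
      by (simp add: rot_e3 trig mat3_simps hh) (use e' in \<open>simp add: algebra_simps\<close>)
    then show ?thesis unfolding h_def g[symmetric] .
  qed
  with s show ?thesis using that by blast
qed

text \<open>If \<open>rot e3 \<theta>\<close> is the conjugate of \<open>S\<close>, then \<open>S\<close> fixes the third row \<open>v\<close> of \<open>g\<close> and has
  the same trace. A rotation \<open>S\<close> about \<open>e3\<close> fixes \<open>v\<close> only if it is the identity or \<open>v\<close> is
  vertical; a flip reverses the third coordinate, hence \<open>v\<close> is horizontal, and has trace \<open>-1\<close>, hence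
  \<open>\<theta>\<close> is a half-turn.\<close>

lemma rot_e3_conj_Dih_cases:
  assumes m: "m \<ge> 1" and g: "orthogonal_matrix g" and R: "rot e3 \<theta> \<in> conj_by g (Dih m)"
  obtains "rot e3 \<theta> = mat 1"
  | "g $ 3 $ 1 = 0" "g $ 3 $ 2 = 0" "rot e3 \<theta> \<in> conj_by g (Zrot m)"
  | "g $ 3 $ 3 = 0" "rot e3 \<theta> = rot e3 pi"
proof -
  obtain S where S: "S \<in> Dih m" "rot e3 \<theta> = g ** S ** transpose g"
    using R by (auto simp: conj_by_transpose[OF g])
  define v where "v = g $ 3"
  have gg: "transpose g ** g = mat 1" "g ** transpose g = mat 1"
    using g by (auto simp: orthogonal_matrix_def)
  have v: "transpose g *v e3 = v"
    by (simp add: v_def matrix_vector_mult_def transpose_def axis_def vec_eq_iff sum_3 forall_3)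
  have RS: "transpose g ** rot e3 \<theta> = S ** transpose g"
    unfolding S(2) by (metis gg(1) matrix_mul_assoc matrix_mul_lid)
  have "rot e3 \<theta> *v e3 = e3"
    by (simp add: rot_e3 matrix_vector_mult_def vec_eq_iff sum_3 forall_3) (simp add: axis_def)
  then have fixed: "S *v v = v" by (metis RS matrix_vector_mul_assoc v)
  have "trace (rot e3 \<theta>) = trace (transpose g ** (g ** S))"
    unfolding S(2) by (rule trace_mul_sym)
  then have tr: "trace (rot e3 \<theta>) = trace S" by (simp add: matrix_mul_assoc gg)
  from S(1) consider "S \<in> Zrot m" | \<phi> where "S = rot e3 \<phi> ** rot e1 pi"
    unfolding Dih_eq[OF m] Zrot_def by auto
  then show ?thesis
  proof cases
    case 1
    then obtain \<phi> where \<phi>: "S = rot e3 \<phi>" by (auto simp: Zrot_def)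
    have eqs: "cos \<phi> * v$1 - sin \<phi> * v$2 = v$1" "sin \<phi> * v$1 + cos \<phi> * v$2 = v$2"
      using fixed by (simp_all add: \<phi> rot_e3 matrix_vector_mult_def vec_eq_iff sum_3 forall_3)
    \<comment> \<open>The inner product of \<open>S v - v\<close> with \<open>v\<close>, in the horizontal plane.\<close>
    have "(cos \<phi> - 1) * (v$1 * v$1 + v$2 * v$2)
      = v$1 * ((cos \<phi> * v$1 - sin \<phi> * v$2) - v$1) + v$2 * ((sin \<phi> * v$1 + cos \<phi> * v$2) - v$2)"
      by (simp add: algebra_simps)
    also have "\<dots> = 0" using eqs by simp
    finally consider "cos \<phi> = 1" | "v$1 = 0" "v$2 = 0" by (auto simp: sum_squares_eq_zero_iff)
    then show ?thesis
    proof cases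
      case 1
      then have "cos \<theta> = 1" using tr by (simp add: \<phi> trace_rot_e3)
      moreover from this have "sin \<theta> = 0" using sin_cos_squared_add[of \<theta>] by simp
      ultimately have "rot e3 \<theta> = mat 1" by (simp add: rot_e3 mat3_simps)
      then show ?thesis using that by blast
    next
      case 2
      then show ?thesis using that(2) S(2) \<open>S \<in> Zrot m\<close>
        by (auto simp: v_def conj_by_transpose[OF g])
    qed
  next
    case 2
    have "v$3 = - v$3"
      using arg_cong[OF fixed, of "\<lambda>w. w $ 3"]
      by (simp add: 2 rot_e3 rot_e1 matrix_vector_mult_def matrix_matrix_mult_def sum_3)
    moreover have "trace S = -1"
      by (simp add: 2 rot_e3 rot_e1 trace_def matrix_matrix_mult_def sum_3)
    then have "cos \<theta> = -1" using tr by (simp add: trace_rot_e3)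
    moreover from this have "sin \<theta> = 0" using sin_cos_squared_add[of \<theta>] by simp
    ultimately have "v$3 = 0" "rot e3 \<theta> = rot e3 pi" by (simp_all add: rot_e3)
    then show ?thesis using that v_def by blast
  qed
qed

lemma conj_Zrot_vertical:
  assumes m: "m \<ge> 1" and g: "orthogonal_matrix g" and v: "g $ 3 $ 1 = 0" "g $ 3 $ 2 = 0"
  shows "conj_by g (Zrot m) = Zrot m"
proof -
  obtain s where s: "s = 1 \<or> s = -1" and
    conj: "\<And>\<theta>. g ** rot e3 \<theta> ** transpose g = rot e3 (s * \<theta>)"
    using conj_rot_e3_vertical[OF g v] by metis
  have "conj_by g (Zrot m) = range (\<lambda>a. rot e3 (s * (2 * pi * real_of_int a / real m)))"
    unfolding conj_by_transpose[OF g] Zrot_int[OF m] image_image conj ..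
  also have "\<dots> = Zrot m"
    using s
  proof
    assume "s = 1" then show ?thesis by (simp add: Zrot_int[OF m])
  next
    assume s: "s = -1"
    have "range (\<lambda>a. rot e3 (- (2 * pi * real_of_int a / real m))) = Zrot m"
      unfolding Zrot_int[OF m]
    proof (intro equalityI subsetI; elim rangeE)
      fix x a assume "x = rot e3 (- (2 * pi * real_of_int a / real m))"
      then have "x = rot e3 (2 * pi * real_of_int (- a) / real m)" by simp
      then show "x \<in> range (\<lambda>a. rot e3 (2 * pi * real_of_int a / real m))" by blast
    next
      fix x a assume "x = rot e3 (2 * pi * real_of_int a / real m)"
      then have "x = rot e3 (- (2 * pi * real_of_int (- a) / real m))" by simp
      then show "x \<in> range (\<lambda>a. rot e3 (- (2 * pi * real_of_int a / real m)))" by blast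
    qed
    then show ?thesis using s by simp
  qed
  finally show ?thesis .
qed

lemma rot_e3_mem_conj_Dih_vertical:
  assumes m: "m \<ge> 1" and g: "orthogonal_matrix g" and v: "g $ 3 $ 1 = 0" "g $ 3 $ 2 = 0"
  shows "rot e3 \<theta> \<in> conj_by g (Dih m) \<longleftrightarrow> rot e3 \<theta> \<in> Zrot m"
proof
  assume "rot e3 \<theta> \<in> Zrot m"
  then have "rot e3 \<theta> \<in> conj_by g (Zrot m)" using conj_Zrot_vertical[OF assms] by simp
  then show "rot e3 \<theta> \<in> conj_by g (Dih m)" unfolding Dih_eq[OF m] conj_by_def by blast
next
  assume R: "rot e3 \<theta> \<in> conj_by g (Dih m)"
  show "rot e3 \<theta> \<in> Zrot m"
    using m g R
  proof (cases rule: rot_e3_conj_Dih_cases)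
    case 1
    then show ?thesis using one_mem_Zrot[OF m] by simp
  next
    case 2
    then show ?thesis using conj_Zrot_vertical[OF assms] by simp
  next
    case 3
    have "(g ** transpose g) $ 3 $ 3 = 0"
      using v 3 by (simp add: mat3_simps)
    moreover have "g ** transpose g = mat 1" using g by (simp add: orthogonal_matrix_def)
    ultimately show ?thesis by (simp add: mat_def)
  qed
qed

section \<open>The possible intersections\<close>

lemma rot_e3_mem_Zrot_iff:
  assumes n: "n \<ge> 1" and m: "m \<ge> 1"
  shows "rot e3 (pi * real_of_int a / real n) \<in> Zrot m \<longleftrightarrow> 2 * int n dvd int m * a"
proof -
  have "rot e3 (pi * real_of_int a / real n) \<in> Zrot m \<longleftrightarrow>
    (\<exists>b k. pi * real_of_int a / real n = 2 * pi * real_of_int b / real m + 2 * pi * real_of_int k)"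
    unfolding Zrot_int[OF m] image_iff rot_e3_eq_iff by simp
  also have "\<dots> \<longleftrightarrow> (\<exists>b k. int m * a = 2 * int n * (b + int m * k))"
  proof -
    have "pi * real_of_int a / real n = 2 * pi * real_of_int b / real m + 2 * pi * real_of_int k
      \<longleftrightarrow> int m * a = 2 * int n * (b + int m * k)" for b k :: int
    proof -
      have "pi * real_of_int a / real n = 2 * pi * real_of_int b / real m + 2 * pi * real_of_int k
        \<longleftrightarrow> real_of_int a / real n = 2 * real_of_int b / real m + 2 * real_of_int k"
      proof -
        have "2 * pi * real_of_int b / real m + 2 * pi * real_of_int k
          = pi * (2 * real_of_int b / real m + 2 * real_of_int k)" by (simp add: algebra_simps)
        then show ?thesis by (metis mult_cancel_left pi_neq_zero times_divide_eq_right)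
      qed
      also have "\<dots> \<longleftrightarrow> real_of_int (int m * a) = real_of_int (2 * int n * (b + int m * k))"
        using n m by (simp add: field_simps)
      finally show ?thesis by (simp only: of_int_eq_iff)
    qed
    then show ?thesis by simp
  qed
  also have "\<dots> \<longleftrightarrow> 2 * int n dvd int m * a"
  proof
    assume "2 * int n dvd int m * a"
    then obtain b where "int m * a = 2 * int n * (b + int m * 0)" by (auto elim: dvdE)
    then show "\<exists>b k. int m * a = 2 * int n * (b + int m * k)" by blast
  qed auto
  finally show ?thesis .
qed

text \<open>Equal principal axes. After division by \<open>d\<close> the divisibility condition splits into \<open>n'\<close>
  dividing \<open>a\<close> and a parity condition on the quotient; coprimality makes \<open>n'\<close> odd when \<open>m'\<close> is even,
  so that the sign attached to \<open>a\<close> is the one attached to the quotient.\<close>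

lemma signed_rotations_in_Zrot:
  assumes n: "n \<ge> 1" and m: "m \<ge> 1" and d: "d = gcd m n"
  shows "{signed a (rot e3 (pi * real_of_int a / real n)) | a.
       rot e3 (pi * real_of_int a / real n) \<in> Zrot m}
     = (if even (m div d) then Zminus d else Zrot d)" (is "?L = _")
proof -
  have d1: "d \<ge> 1" using m d by (simp add: Suc_le_eq)
  define m' n' where "m' = m div d" "n' = n div d"
  have mn: "m = d * m'" "n = d * n'" by (simp_all add: m'_n'_def d)
  have cop: "coprime m' n'" unfolding m'_n'_def d by (rule div_gcd_coprime) (use n in simp)
  have n'0: "n' \<ge> 1" using n mn by (cases n') auto
  have dvd: "2 * int n dvd int m * a \<longleftrightarrow> 2 * int n' dvd int m' * a" for a
  proof -
    have "2 * int n dvd int m * a \<longleftrightarrow> int d * (2 * int n') dvd int d * (int m' * a)"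
      by (simp add: mn mult_ac)
    then show ?thesis using d1 by simp
  qed
  have dvd': "2 * int n dvd int m * a \<longleftrightarrow> (\<exists>c. a = int n' * c \<and> even (int m' * c))" for a
  proof
    assume "2 * int n dvd int m * a"
    then have D: "2 * int n' dvd int m' * a" using dvd by simp
    then have "int n' dvd int m' * a" using dvd_mult_right by blast
    then have "int n' dvd a" using cop by (simp add: coprime_dvd_mult_right_iff coprime_commute)
    then obtain c where c: "a = int n' * c" by blast
    have "int n' * 2 dvd int n' * (int m' * c)" using D by (simp add: c mult_ac)
    then have "even (int m' * c)" using n'0 unfolding dvd_mult_cancel_left by simp
    then show "\<exists>c. a = int n' * c \<and> even (int m' * c)" using c by blast
  next
    assume "\<exists>c. a = int n' * c \<and> even (int m' * c)"
    then obtain c where c: "a = int n' * c" "even (int m' * c)" by blast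
    have "2 * int n' dvd (int m' * c) * int n'" using c(2) by (intro mult_dvd_mono) simp_all
    then have "2 * int n' dvd int m' * a" by (simp add: c(1) mult_ac)
    then show "2 * int n dvd int m * a" using dvd by simp
  qed
  have angle: "pi * real_of_int (int n' * c) / real n = pi * real_of_int c / real d" for c
    using n'0 d1 by (simp add: mn field_simps)
  have "?L = {signed a (rot e3 (pi * real_of_int a / real n)) | a.
      \<exists>c. a = int n' * c \<and> even (int m' * c)}"
    by (simp only: rot_e3_mem_Zrot_iff[OF n m] dvd')
  also have "\<dots> = {signed (int n' * c) (rot e3 (pi * real_of_int (int n' * c) / real n)) | c.
      even (int m' * c)}"
    by blast
  finally have L: "?L = {signed (int n' * c) (rot e3 (pi * real_of_int c / real d)) | c.
      even (int m' * c)}"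
    by (simp only: angle)
  show ?thesis
  proof (cases "even m'")
    case True
    then have "odd n'" using cop by (metis coprime_common_divisor odd_one)
    then have "signed (int n' * c) M = signed c M" for c M by (simp add: signed_def)
    then have "?L = {signed c (rot e3 (pi * real_of_int c / real d)) | c. even (int m' * c)}"
      unfolding L by (simp only:)
    also have "\<dots> = range (\<lambda>c. signed c (rot e3 (pi * real_of_int c / real d)))"
      using True by auto
    finally show ?thesis using True by (simp add: Zminus_signed[OF d1] flip: m'_n'_def)
  next
    case False
    have "?L = range (\<lambda>e. rot e3 (2 * pi * real_of_int e / real d))"
    proof -
      have "?L = {signed (int n' * c) (rot e3 (pi * real_of_int c / real d)) | c. even c}"
        using False by (simp add: L)
      also have "\<dots> = {rot e3 (pi * real_of_int c / real d) | c. even c}"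
        by (auto simp: signed_def)
      also have "\<dots> = (\<lambda>c. rot e3 (pi * real_of_int c / real d)) ` {c. even c}" by blast
      also have "{c::int. even c} = range (\<lambda>e. 2 * e)" by (auto elim: evenE)
      finally show ?thesis by (simp add: image_image mult_ac)
    qed
    then show ?thesis using False by (simp add: Zrot_int[OF d1] flip: m'_n'_def)
  qed
qed

lemma Zcal_eq: "Zcal n = conj_class {mat 1, signed (int n) (rot e3 pi)}"
proof -
  have Z2: "Zrot 2 = {mat 1, rot e3 pi}"
  proof -
    have "Zrot 2 = (\<lambda>j. rot e3 (2 * real j * pi / real 2)) ` {..<2}"
      unfolding Zrot_def by blast
    moreover have "{..<2} = {0, 1::nat}" by auto
    ultimately show ?thesis by (simp add: rot_e3_0)
  qed
  have "Zrot 1 = {mat 1}" by (auto simp: Zrot_def rot_e3_0)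
  then have "Zminus 1 = {mat 1, - rot e3 pi}" by (simp add: Zminus_def insert_commute)
  then show ?thesis using Z2 by (simp add: Zcal_def signed_def)
qed

text \<open>Distinct principal axes. The angle \<open>a \<pi> / n\<close> is \<open>0\<close> modulo \<open>2 \<pi>\<close> only for \<open>a\<close> an even
  multiple of \<open>n\<close>, and \<open>\<pi>\<close> only for an odd multiple; the sign is then positive, respectively that
  of \<open>n\<close>, so it is determined by the rotation.\<close>

lemma signed_rotations_half_turn:
  assumes n: "n \<ge> 1" and one: "mat 1 \<in> K"
    and half: "\<And>\<theta>. rot e3 \<theta> \<in> K \<Longrightarrow> rot e3 \<theta> = mat 1 \<or> rot e3 \<theta> = rot e3 pi"
  shows "{signed a (rot e3 (pi * real_of_int a / real n)) | a.
       rot e3 (pi * real_of_int a / real n) \<in> K}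
     = (if rot e3 pi \<in> K then {mat 1, signed (int n) (rot e3 pi)} else {mat 1})" (is "?L = ?R")
proof (intro Set.set_eqI iffI)
  fix x assume "x \<in> ?L"
  then obtain a where x: "x = signed a (rot e3 (pi * real_of_int a / real n))"
    and K: "rot e3 (pi * real_of_int a / real n) \<in> K" by blast
  have cancel: "a = q * int n" if "pi * real_of_int a / real n = pi * real_of_int q" for q
  proof -
    have "real_of_int a = real_of_int (q * int n)" using that n by (simp add: field_simps)
    then show ?thesis by (simp only: of_int_eq_iff)
  qed
  from half[OF K] show "x \<in> ?R"
  proof
    assume R: "rot e3 (pi * real_of_int a / real n) = mat 1"
    then obtain k where "pi * real_of_int a / real n = pi * real_of_int (2 * k)"
      unfolding rot_e3_0[symmetric] rot_e3_eq_iff by auto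
    then have "a = 2 * k * int n" by (rule cancel)
    then have "even a" by simp
    then show ?thesis using x R by (simp add: signed_def)
  next
    assume R: "rot e3 (pi * real_of_int a / real n) = rot e3 pi"
    then obtain k where "pi * real_of_int a / real n = pi * real_of_int (1 + 2 * k)"
      unfolding rot_e3_eq_iff by (auto simp: algebra_simps)
    then have "a = (1 + 2 * k) * int n" by (rule cancel)
    then have "even a \<longleftrightarrow> even (int n)" by simp
    then show ?thesis using x R K by (simp add: signed_def)
  qed
next
  fix x assume "x \<in> ?R"
  then consider "x = mat 1" | "rot e3 pi \<in> K" "x = signed (int n) (rot e3 pi)"
    by (auto split: if_splits)
  then show "x \<in> ?L"
  proof cases
    case 1
    then have "x = signed 0 (rot e3 (pi * real_of_int 0 / real n))"
      "rot e3 (pi * real_of_int 0 / real n) \<in> K"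
      using one by (simp_all add: signed_def rot_e3_0)
    then show ?thesis by blast
  next
    case 2
    have "pi * real_of_int (int n) / real n = pi" using n by simp
    then have "x = signed (int n) (rot e3 (pi * real_of_int (int n) / real n))"
      "rot e3 (pi * real_of_int (int n) / real n) \<in> K" using 2 by (simp_all only:)
    then show ?thesis by blast
  qed
qed

section \<open>The clips operation\<close>

theorem lemma4p4:
  fixes n m d :: nat
  assumes "n \<ge> 1" and "m \<ge> 2" and "d = gcd m n"
  shows "conj_class (Zminus n) \<circledcirc> conj_class (plus_Z2c (Dih m)) =
    (if even (m div d)
     then {conj_class trivial_subgroup, conj_class (Zminus d), Zcal n}
     else {conj_class trivial_subgroup, conj_class (Zrot d), Zcal n})"
proof -
  note n = assms(1) and d = assms(3)
  have m: "m \<ge> 1" using assms(2) by simp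
  have D: "plus_Z2c (Dih m) \<subseteq> carrier O3"
    using Dih_carrier[OF m] uminus_carrier_O3 by (auto simp: plus_Z2c_def)
  define I where "I g = Zminus n \<inter> conj_by g (plus_Z2c (Dih m))" for g
  define V where "V = (if even (m div d) then Zminus d else Zrot d)"
  have I_eq: "I g = {signed a (rot e3 (pi * real_of_int a / real n)) | a.
      rot e3 (pi * real_of_int a / real n) \<in> conj_by g (Dih m)}" if "orthogonal_matrix g" for g
    unfolding I_def by (rule Zminus_Int_conj_plus_Z2c[OF n that det_Dih[OF m]])
  have clips: "conj_class (Zminus n) \<circledcirc> conj_class (plus_Z2c (Dih m))
      = {conj_class (I g) | g. orthogonal_matrix g}"
    by (simp add: clips_conj_class[OF Zminus_carrier[OF n] D] I_def carrier_O3_iff)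
  have vertical: "I g = V" if "orthogonal_matrix g" "g $ 3 $ 1 = 0" "g $ 3 $ 2 = 0" for g
    unfolding I_eq[OF that(1)] rot_e3_mem_conj_Dih_vertical[OF m that] V_def
    by (rule signed_rotations_in_Zrot[OF n m d])
  have tilted: "I g = (if rot e3 pi \<in> conj_by g (Dih m)
        then {mat 1, signed (int n) (rot e3 pi)} else {mat 1})"
    if g: "orthogonal_matrix g" and nv: "g $ 3 $ 1 \<noteq> 0 \<or> g $ 3 $ 2 \<noteq> 0" for g
  proof -
    have "mat 1 \<in> Dih m"
      using generate.one[of O3] unfolding Dih_def by (simp add: O3_def)
    then have "g ** mat 1 ** transpose g \<in> conj_by g (Dih m)"
      unfolding conj_by_transpose[OF g] by blast
    then have one: "mat 1 \<in> conj_by g (Dih m)" using g by (simp add: orthogonal_matrix_def)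
    show ?thesis
      unfolding I_eq[OF g]
      by (rule signed_rotations_half_turn[OF n one]) (erule rot_e3_conj_Dih_cases[OF m g], use nv in auto)
  qed
  have realised: "conj_class X \<in> {conj_class (I g) | g. orthogonal_matrix g}"
    if "orthogonal_matrix g" "I g = X" for g X
    using that by blast
  have V: "conj_class V \<in> {conj_class (I g) | g. orthogonal_matrix g}"
  proof -
    have "I (mat 1) = V"
      by (rule vertical) (simp_all add: orthogonal_matrix_id, simp_all add: mat_def)
    then show ?thesis by (rule realised[OF orthogonal_matrix_id])
  qed
  have T: "conj_class {mat 1} \<in> {conj_class (I g) | g. orthogonal_matrix g}"
  proof -
    \<comment> \<open>A tilt whose third row is neither vertical nor horizontal.\<close>
    let ?g = "rot e1 (pi / 4)"
    have g: "orthogonal_matrix ?g" by (rule orthogonal_rot_e1)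
    have e: "?g $ 3 $ 2 \<noteq> 0" "?g $ 3 $ 3 \<noteq> 0" by (simp_all add: rot_e1 sin_45 cos_45)
    have "rot e3 pi \<noteq> mat 1" by (simp add: rot_e3 mat3_simps)
    then have "rot e3 pi \<notin> conj_by ?g (Dih m)"
      using e by (auto elim: rot_e3_conj_Dih_cases[OF m g])
    then have "I ?g = {mat 1}" using tilted[OF g disjI2[OF e(1)]] by simp
    then show ?thesis by (rule realised[OF g])
  qed
  have H: "Zcal n \<in> {conj_class (I g) | g. orthogonal_matrix g}"
  proof -
    \<comment> \<open>The cyclic permutation with \<open>?g *v e1 = e3\<close>, which carries the flip to \<open>rot e3 pi\<close>.\<close>
    let ?g = "vector [vector [0, 1, 0], vector [0, 0, 1], vector [1, 0, 0]] :: real^3^3"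
    have g: "orthogonal_matrix ?g" by (simp add: orthogonal_matrix mat3_simps)
    have "rot e1 pi \<in> Dih m" unfolding Dih_def by (rule generate.incl) simp
    moreover have "rot e3 pi = ?g ** rot e1 pi ** transpose ?g"
      by (simp add: rot_e3 rot_e1 mat3_simps)
    ultimately have "rot e3 pi \<in> conj_by ?g (Dih m)" by (auto simp: conj_by_transpose[OF g])
    moreover have "?g $ 3 $ 1 \<noteq> 0" by simp
    ultimately have "I ?g = {mat 1, signed (int n) (rot e3 pi)}"
      using tilted[OF g disjI1] by (simp only: if_True not_False_eq_True)
    then show ?thesis unfolding Zcal_eq by (rule realised[OF g])
  qed
  have "conj_class (I g) \<in> {conj_class {mat 1}, conj_class V, Zcal n}" if "orthogonal_matrix g" for g
  proof (cases "g $ 3 $ 1 = 0 \<and> g $ 3 $ 2 = 0")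
    case True
    then show ?thesis using vertical[OF that] by simp
  next
    case False
    then show ?thesis using tilted[OF that] by (simp add: Zcal_eq)
  qed
  then have "{conj_class (I g) | g. orthogonal_matrix g} = {conj_class {mat 1}, conj_class V, Zcal n}"
    using V T H by blast
  then show ?thesis by (simp add: clips V_def trivial_subgroup_def)
qed

end
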